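(* Let $N\ge1$ be an integer and consider the irregular half-product code with the uniform distribution $\tau_{\mathsf{t}}=1/N$ for $\mathsf{t}\in\{1,\dots,N\}$ (so $\mathsf{t}_{\max}=N$ and the mean erasure-correcting capability is $\bar{\mathsf{t}}=(N+1)/2$). Then its decoding threshold $c^*$ satisfies $$2\bar{\mathsf{t}}-1\le c^*\le 2\bar{\mathsf{t}}.$$
   Context: Notation: $\Psi_{\ge s}(\lambda)=\mathbb{P}(X\ge s)=1-\sum_{i=0}^{s-1}\frac{\lambda^i}{i!}e^{-\lambda}$ where $X$ is Poisson with mean $\lambda$. For a probability vector $\boldsymbol\tau=(\tau_1,\dots,\tau_{\mathsf{t}_{\max}})$, where $\tau_{\mathsf{t}}$ is the fraction of component codes of an irregular half-product code that correct $\mathsf{t}$ erasures, the mean erasure-correcting capability is $\bar{\mathsf{t}}=\sum_{\mathsf{t}=1}^{\mathsf{t}_{\max}}\tau_{\mathsf{t}}\,\mathsf{t}$. For $c>0$ the density evolution recursion is $x^{(0)}=1$ and $x^{(\ell)}=\sum_{\mathsf{t}=1}^{\mathsf{t}_{\max}}\tau_{\mathsf{t}}\Psi_{\ge\mathsf{t}}(c\,x^{(\ell-1)})$ for $\ell\ge1$. The decoding threshold is $c^*=\sup\{c>0 : \lim_{\ell\to\infty}x^{(\ell)}=0\}$. *)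

theory Defs
  imports "HOL-Probability.Probability"
begin

text \<open>
  A degree distribution on \<open>{1..tmax}\<close> is a function \<open>tau :: nat \<Rightarrow> real\<close>, of which only the
  values on \<open>{1..tmax}\<close> are used.
\<close>

definition prob_vector :: "nat \<Rightarrow> (nat \<Rightarrow> real) \<Rightarrow> bool" where
  "prob_vector tmax tau \<longleftrightarrow> (\<forall>t\<in>{1..tmax}. 0 \<le> tau t) \<and> (\<Sum>t=1..tmax. tau t) = 1"

definition mean_capability :: "nat \<Rightarrow> (nat \<Rightarrow> real) \<Rightarrow> real" where
  "mean_capability tmax tau = (\<Sum>t=1..tmax. tau t * real t)"

text \<open>
  The explicit formula also covers mean \<open>0\<close>; \<open>poisson_pmf\<close> is characterised only for positive mean.
\<close>

definition poisson_tail :: "nat \<Rightarrow> real \<Rightarrow> real" where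
  "poisson_tail s l = 1 - (\<Sum>i<s. l ^ i / fact i * exp (- l))"

lemma poisson_tail_eq_prob:
  assumes "0 < l"
  shows "poisson_tail s l = measure_pmf.prob (poisson_pmf l) {s..}"
proof -
  have "measure_pmf.prob (poisson_pmf l) {s..} = 1 - measure_pmf.prob (poisson_pmf l) {..<s}"
    using measure_pmf.prob_compl[of "{..<s}" "poisson_pmf l"]
    by (simp add: Compl_eq_Diff_UNIV[symmetric] Compl_lessThan)
  also have "measure_pmf.prob (poisson_pmf l) {..<s} = (\<Sum>i<s. l ^ i / fact i * exp (- l))"
    using assms by (simp add: measure_measure_pmf_finite)
  finally show ?thesis
    by (simp add: poisson_tail_def)
qed

primrec density_evolution :: "nat \<Rightarrow> (nat \<Rightarrow> real) \<Rightarrow> real \<Rightarrow> nat \<Rightarrow> real" where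
  "density_evolution tmax tau c 0 = 1"
| "density_evolution tmax tau c (Suc l) =
     (\<Sum>t=1..tmax. tau t * poisson_tail t (c * density_evolution tmax tau c l))"

text \<open>
  The supremum is taken in the extended reals, so that it is meaningful without knowing in advance
  that the set is nonempty and bounded; finite bounds on it entail both.
\<close>

definition decoding_threshold :: "nat \<Rightarrow> (nat \<Rightarrow> real) \<Rightarrow> ereal" where
  "decoding_threshold tmax tau =
     Sup (ereal ` {c. 0 < c \<and> density_evolution tmax tau c \<longlonglongrightarrow> 0})"

definition uniform_distribution :: "nat \<Rightarrow> nat \<Rightarrow> real" where
  "uniform_distribution N t = (if t \<in> {1..N} then 1 / real N else 0)"

lemma prob_vector_uniform: "1 \<le> N \<Longrightarrow> prob_vector N (uniform_distribution N)"
  by (simp add: prob_vector_def uniform_distribution_def)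

lemma mean_capability_uniform:
  assumes "1 \<le> N"
  shows "mean_capability N (uniform_distribution N) = (real N + 1) / 2"
proof -
  have "2 * (\<Sum>t=1..n. real t) = real n * (real n + 1)" for n
    by (induction n) (auto simp: algebra_simps)
  then have "(\<Sum>t=1..N. real t) = real N * (real N + 1) / 2"
    by (metis nonzero_mult_div_cancel_left zero_neq_numeral)
  moreover have "mean_capability N (uniform_distribution N) = (\<Sum>t=1..N. real t) / real N"
    by (simp add: mean_capability_def uniform_distribution_def sum_divide_distrib)
  ultimately show ?thesis
    using assms by simp
qed

end

theory Submission
  imports Defs
begin

text \<open>
  The threshold is exactly \<open>N\<close>, so the lower bound is attained. For a Poisson variable
  \<open>X\<close> of mean \<open>l\<close>, the sum of \<open>P (X \<ge> t)\<close> over \<open>t = 1..N\<close> is the expectation of \<open>min X N\<close>, which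
  is at most \<open>l\<close>. So one step of density evolution contracts by the factor \<open>c / N\<close> when \<open>c < N\<close>.
  When \<open>c > N\<close>, already the term \<open>P (X \<ge> 1) = 1 - exp (- l)\<close> makes \<open>0\<close> unstable, and the
  recursion never falls below \<open>1 / N - 1 / c\<close>.
\<close>

text \<open>The subtracted sum is a partial sum of the exponential series, scaled by
  \<open>exp (- l)\<close>. Arguing from the series includes mean \<open>0\<close>, where
  \<open>poisson_tail_eq_prob\<close> does not apply.\<close>

lemma poisson_tail_nonneg:
  assumes "0 \<le> l"
  shows "0 \<le> poisson_tail s l"
proof -
  have "(\<Sum>i<s. l ^ i / fact i) \<le> exp l"
    unfolding exp_def using summable_exp_generic[of l] assms
    by (auto simp: divide_inverse_commute intro!: sum_le_suminf)
  then have "(\<Sum>i<s. l ^ i / fact i) * exp (- l) \<le> exp l * exp (- l)"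
    by (intro mult_right_mono) auto
  then show ?thesis
    by (simp add: poisson_tail_def sum_distrib_right exp_minus)
qed

lemma poisson_tail_1: "poisson_tail 1 l = 1 - exp (- l)"
  by (simp add: poisson_tail_def)

lemma poisson_tail_Suc_at_0: "poisson_tail (Suc s) 0 = 0"
  by (simp add: poisson_tail_def lessThan_Suc_atMost sum.atMost_shift)

lemma poisson_tail_Suc:
  "poisson_tail (Suc s) l = poisson_tail s l - l ^ s / fact s * exp (- l)"
  by (simp add: poisson_tail_def)

text \<open>Differentiating a Poisson weight gives the difference of two neighbouring weights, so
  the sum telescopes to its last weight.\<close>

lemma has_derivative_poisson_tail:
  "((\<lambda>l. poisson_tail (Suc s) l) has_real_derivative l ^ s / fact s * exp (- l)) (at l)"
proof (induction s)
  case 0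
  show ?case
    unfolding One_nat_def[symmetric] poisson_tail_1 by (auto intro!: derivative_eq_intros)
next
  case (Suc s)
  have "((\<lambda>l. l ^ Suc s / fact (Suc s)) has_real_derivative
      real (Suc s) * l ^ s / fact (Suc s)) (at l)"
    by (intro DERIV_cdivide) (use DERIV_pow[of "Suc s" l] in simp)
  also have "real (Suc s) * l ^ s / fact (Suc s) = l ^ s / fact s"
    by (simp del: of_nat_Suc)
  finally have "((\<lambda>l. l ^ Suc s / fact (Suc s)) has_real_derivative l ^ s / fact s) (at l)" .
  moreover have "((\<lambda>l. exp (- l)) has_real_derivative - exp (- l)) (at l)"
    by (auto intro!: derivative_eq_intros)
  ultimately have "((\<lambda>l. l ^ Suc s / fact (Suc s) * exp (- l)) has_real_derivative
      l ^ s / fact s * exp (- l) + - exp (- l) * (l ^ Suc s / fact (Suc s))) (at l)"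
    by (rule DERIV_mult)
  from DERIV_diff[OF Suc.IH this] show ?case
    by (simp add: poisson_tail_Suc[of "Suc s"] mult.commute)
qed

lemma sum_poisson_tail_le:
  assumes "0 \<le> l"
  shows "(\<Sum>t=1..N. poisson_tail t l) \<le> l"
proof -
  define g where "g = (\<lambda>l. l - (\<Sum>s<N. poisson_tail (Suc s) l))"
  \<comment> \<open>The derivative is \<open>1\<close> minus the first \<open>N\<close> Poisson
    weights, which is again a tail and hence nonnegative for \<open>y \<ge> 0\<close>.\<close>
  have "(g has_real_derivative poisson_tail N y) (at y)" for y
    unfolding g_def poisson_tail_def[of N]
    by (intro DERIV_diff DERIV_ident DERIV_sum has_derivative_poisson_tail)
  then have "g 0 \<le> g l"
    by (intro DERIV_nonneg_imp_nondecreasing[OF assms]) (blast intro: poisson_tail_nonneg)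
  moreover have "(\<Sum>t=1..N. poisson_tail t l) = (\<Sum>s<N. poisson_tail (Suc s) l)"
    by (simp add: sum.atLeast1_atMost_eq)
  ultimately show ?thesis
    by (simp add: g_def poisson_tail_Suc_at_0)
qed

lemma density_evolution_uniform_Suc:
  "density_evolution N (uniform_distribution N) c (Suc l) =
     (\<Sum>t=1..N. poisson_tail t (c * density_evolution N (uniform_distribution N) c l)) / real N"
  by (simp add: uniform_distribution_def sum_divide_distrib)

lemma density_evolution_uniform_tendsto_0:
  assumes "0 < c" "c < real N"
  shows "density_evolution N (uniform_distribution N) c \<longlonglongrightarrow> 0"
proof -
  let ?x = "density_evolution N (uniform_distribution N) c"
  \<comment> \<open>The lower bound is carried through the induction because the tail estimates
    require a nonnegative mean.\<close>
  have bounds: "0 \<le> ?x l \<and> ?x l \<le> (c / N) ^ l" for l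
  proof (induction l)
    case (Suc l)
    then have nonneg: "0 \<le> c * ?x l"
      using assms by simp
    have "?x (Suc l) \<le> c * ?x l / N"
      unfolding density_evolution_uniform_Suc
      by (intro divide_right_mono sum_poisson_tail_le nonneg) simp
    also have "\<dots> \<le> c / N * (c / N) ^ l"
      using Suc assms mult_left_mono[of "?x l" "(c / N) ^ l" "c / N"] by simp
    finally show ?case
      unfolding density_evolution_uniform_Suc
      using nonneg by (auto intro!: divide_nonneg_nonneg sum_nonneg poisson_tail_nonneg)
  qed simp
  have "(\<lambda>l. (c / N) ^ l) \<longlonglongrightarrow> 0"
    using assms by (intro LIMSEQ_power_zero) simp
  then show ?thesis
    by (rule tendsto_sandwich[OF _ _ tendsto_const, rotated 2]) (use bounds in auto)
qed

text \<open>The constant reproduces itself: \<open>x \<ge> 1 / N - 1 / c\<close> gives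
  \<open>1 + c * x \<ge> c / N\<close>, so \<open>exp (- (c * x)) \<le> N / c\<close>, and the term
  \<open>t = 1\<close> alone contributes at least
  \<open>(1 - N / c) / N = 1 / N - 1 / c\<close>.\<close>

lemma density_evolution_uniform_ge:
  assumes "1 \<le> N" "real N < c"
  shows "1 / N - 1 / c \<le> density_evolution N (uniform_distribution N) c l"
proof (induction l)
  case 0
  have "1 / real N \<le> 1" "0 \<le> 1 / c"
    using assms by auto
  then show ?case
    unfolding density_evolution.simps by linarith
next
  case (Suc l)
  let ?x = "density_evolution N (uniform_distribution N) c l"
  have pos: "0 < c" "0 < real N"
    using assms by auto
  then have "c / N - 1 \<le> c * ?x"
    using mult_left_mono[OF Suc.IH, of c] by (simp add: right_diff_distrib)
  moreover have "1 < c / N"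
    using assms pos by simp
  ultimately have nonneg: "0 \<le> c * ?x" and "c / N \<le> exp (c * ?x)"
    using exp_ge_add_one_self[of "c * ?x"] by linarith+
  then have "exp (- (c * ?x)) \<le> N / c"
    using pos by (simp add: exp_minus field_simps)
  then have "1 - N / c \<le> poisson_tail 1 (c * ?x)"
    by (simp add: poisson_tail_1 del: One_nat_def)
  also have "\<dots> \<le> (\<Sum>t=1..N. poisson_tail t (c * ?x))"
    using assms nonneg by (intro member_le_sum) (auto intro: poisson_tail_nonneg)
  finally have "(1 - N / c) / N \<le> density_evolution N (uniform_distribution N) c (Suc l)"
    unfolding density_evolution_uniform_Suc by (intro divide_right_mono) auto
  then show ?case
    using pos by (simp add: diff_divide_distrib del: density_evolution.simps)
qed

lemma density_evolution_uniform_not_tendsto_0: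
  assumes "1 \<le> N" "real N < c"
  shows "\<not> density_evolution N (uniform_distribution N) c \<longlonglongrightarrow> 0"
proof
  assume "density_evolution N (uniform_distribution N) c \<longlonglongrightarrow> 0"
  then have "1 / N - 1 / c \<le> 0"
    using density_evolution_uniform_ge[OF assms] by (intro LIMSEQ_le_const) auto
  moreover have "1 / c < 1 / N"
    using assms by (intro divide_strict_left_mono) auto
  ultimately show False
    by simp
qed

lemma decoding_threshold_uniform:
  assumes "1 \<le> N"
  shows "decoding_threshold N (uniform_distribution N) = ereal N"
proof (rule antisym)
  show "decoding_threshold N (uniform_distribution N) \<le> ereal N"
    unfolding decoding_threshold_def
    using density_evolution_uniform_not_tendsto_0[OF assms]
    by (intro Sup_least) (force simp: not_less[symmetric])
  show "ereal N \<le> decoding_threshold N (uniform_distribution N)"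
  \<comment> \<open>Only values strictly between \<open>0\<close> and \<open>N\<close> are tested;
    they are finite and lie in the set, so the critical case \<open>c = N\<close> is never
    examined.\<close>
  proof (rule dense_le_bounded)
    show "0 < ereal N"
      using assms by simp
    fix w :: ereal
    assume w: "0 < w" "w < ereal N"
    then obtain c where "w = ereal c"
      by (cases w) auto
    with w show "w \<le> decoding_threshold N (uniform_distribution N)"
      unfolding decoding_threshold_def
      by (auto intro!: Sup_upper imageI density_evolution_uniform_tendsto_0)
  qed
qed

theorem mainTheorem4:
  fixes N :: nat
  assumes "N \<ge> 1"
  shows "ereal (2 * mean_capability N (uniform_distribution N) - 1)
           \<le> decoding_threshold N (uniform_distribution N)
       \<and> decoding_threshold N (uniform_distribution N)
           \<le> ereal (2 * mean_capability N (uniform_distribution N))"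
  \<comment> \<open>Twice the mean is \<open>N + 1\<close>, so the claim reads
    \<open>N \<le> N \<le> N + 1\<close>.\<close>
  using assms by (simp add: decoding_threshold_uniform mean_capability_uniform field_simps)

end
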